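(* Let $\mathcal{S}\subseteq S_n$ have size $n$. Define $$T:=\{\{i,j\} : vw^{-1}=(i~j) \text{ for some } v,w\in\mathcal{S}\}$$ and consider $T$ as (the edge set of) a graph on the vertex set $[n]=\{1,\dots,n\}$. If $T$ is connected, then $\mathcal{S}$ is a persistent simplex.
   Context: $S_n$ acts on $\mathbb{R}^n$ by permuting coordinates, as the finite reflection group with roots $e_i-e_j$ ($i\ne j$): $w\cdot(a_1,\dots,a_n)=(a_{w^{-1}(1)},\dots,a_{w^{-1}(n)})$, so that the transposition $(i~j)$ acts as the reflection in $e_i-e_j$, exchanging coordinates $i$ and $j$. The fundamental chamber is $B=\{\mathbf{a}\in\mathbb{R}^n : a_1<a_2<\cdots<a_n\}$. The polytope $\mathrm{conv}(S_n\cdot\mathbf{a})$, $\mathbf{a}\in B$, has dimension $n-1$. A subset $\mathcal{S}\subseteq S_n$ of size $n$ is a persistent simplex if for every $\mathbf{a}\in B$ the polytope $\mathrm{conv}(\mathcal{S}\cdot\mathbf{a})$ is an $(n-1)$-dimensional simplex. *)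

theory Defs
  imports "HOL-Analysis.Analysis"
begin

text \<open>
  The index set \<open>[n]\<close> is a finite linearly ordered type \<open>'n\<close> with \<open>n = CARD('n)\<close>, and \<open>S\<^sub>n\<close> is the
  set of permutations of \<open>'n\<close>.
\<close>

abbreviation sym_grp :: "('n::finite \<Rightarrow> 'n) set" where
  "sym_grp \<equiv> {p. p permutes UNIV}"

text \<open>With the inverse on indices this is a left action, and \<open>(i j)\<close> exchanges the coordinates
  at positions \<open>i\<close> and \<open>j\<close>.\<close>

definition perm_act :: "('n::finite \<Rightarrow> 'n) \<Rightarrow> real ^ 'n \<Rightarrow> real ^ 'n" where
  "perm_act w a = (\<chi> i. a $ (inv w i))"

definition fundamental_chamber :: "(real ^ 'n::{finite,linorder}) set" where
  "fundamental_chamber = {a. \<forall>i j. i < j \<longrightarrow> a $ i < a $ j}"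

definition persistent_simplex :: "('n::{finite,linorder} \<Rightarrow> 'n) set \<Rightarrow> bool" where
  "persistent_simplex S \<longleftrightarrow>
     S \<subseteq> sym_grp \<and> card S = CARD('n) \<and>
     (\<forall>a \<in> fundamental_chamber. (int CARD('n) - 1) simplex (convex hull ((\<lambda>w. perm_act w a) ` S)))"

text \<open>The condition \<open>i \<noteq> j\<close> is needed because \<open>transpose i i\<close> is the identity.\<close>

definition transposition_graph :: "('n::finite \<Rightarrow> 'n) set \<Rightarrow> 'n set set" where
  "transposition_graph S =
     {{i, j} | i j. i \<noteq> j \<and> (\<exists>v\<in>S. \<exists>w\<in>S. v \<circ> inv w = Transposition.transpose i j)}"

text \<open>Connectedness of the undirected graph with vertex set \<open>V\<close> and edge set \<open>E\<close>: any two vertices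
  are joined by a (possibly empty) walk.\<close>

definition graph_connected :: "'v set \<Rightarrow> 'v set set \<Rightarrow> bool" where
  "graph_connected V E \<longleftrightarrow>
     (\<forall>u\<in>V. \<forall>v\<in>V. (u, v) \<in> {(x, y). x \<in> V \<and> y \<in> V \<and> {x, y} \<in> E}\<^sup>*)"

end

theory Submission imports Defs begin

text \<open>
  Fix \<open>a\<close> in the chamber. Its coordinates are distinct, so \<open>S\<cdot>a\<close> consists of \<open>n\<close> points, and it
  suffices to show that they span an affine subspace of dimension at least \<open>n - 1\<close>: then they are
  affinely independent, hence the vertices of a simplex. If \<open>v = (i j) w\<close> with \<open>v, w \<in> S\<close>, then
  \<open>v\<cdot>a\<close> is the reflection of \<open>w\<cdot>a\<close> in the root \<open>e\<^sub>i - e\<^sub>j\<close>, and \<open>v\<cdot>a - w\<cdot>a\<close> is a nonzero multiple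
  of that root (\<open>perm_act_transpose_diff\<close>). So the direction space of the affine span contains
  the root of every edge of the graph. Roots telescope along walks, so connectedness puts every
  \<open>e\<^sub>i - e\<^sub>j\<close> into the direction space (\<open>roots_in_subspace_if_connected\<close>), and these vectors span a
  space of dimension \<open>n - 1\<close> (\<open>dim_if_all_roots\<close>).
\<close>

lemma inj_component_fundamental_chamber:
  assumes "a \<in> fundamental_chamber"
  shows "inj (($) a)"
proof (rule injI)
  fix i j assume "a $ i = a $ j"
  with assms show "i = j"
    unfolding fundamental_chamber_def by (cases i j rule: linorder_cases) force+
qed

lemma perm_act_inj_on_sym_grp:
  assumes "inj (($) a)"
  shows "inj_on (\<lambda>w. perm_act w a) sym_grp"
proof (rule inj_onI)
  fix v w assume v: "v \<in> sym_grp" and w: "w \<in> sym_grp" and eq: "perm_act v a = perm_act w a"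
  have "inv v i = inv w i" for i
    using arg_cong[OF eq, of "\<lambda>x. x $ i"] assms by (simp add: perm_act_def inj_eq)
  then have "inv v = inv w" by blast
  then show "v = w"
    using v w by (metis mem_Collect_eq permutes_inv_inv)
qed

text \<open>
  A transposition acts as the reflection in the corresponding root, so it moves every point
  along that root.
\<close>

lemma perm_act_transpose_diff:
  assumes "bij w"
  shows "perm_act (Transposition.transpose i j \<circ> w) a - perm_act w a
    = (a $ inv w j - a $ inv w i) *\<^sub>R (axis i 1 - axis j 1)"
proof -
  have "inv (Transposition.transpose i j \<circ> w) = inv w \<circ> Transposition.transpose i j"
    using assms by (simp add: o_inv_distrib)
  then show ?thesis
    by (simp add: perm_act_def vec_eq_iff axis_def Transposition.transpose_def)
qed

text \<open>
  For fixed \<open>U\<close>, the relation \<open>e\<^sub>i - e\<^sub>j \<in> U\<close> on indices is reflexive and transitive, so it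
  extends from the edges of a graph to the pairs joined by a walk.
\<close>

lemma roots_in_subspace_if_connected:
  fixes U :: "(real ^ 'n::finite) set"
  assumes U: "subspace U"
    and conn: "graph_connected UNIV E"
    and edge: "\<And>i j. {i, j} \<in> E \<Longrightarrow> axis i 1 - axis j 1 \<in> U"
  shows "axis i 1 - axis j 1 \<in> U"
proof -
  have "(i, j) \<in> {(x, y). {x, y} \<in> E}\<^sup>*"
    using conn by (simp add: graph_connected_def)
  then show ?thesis
  proof (induction rule: rtrancl_induct)
    case base
    show ?case using subspace_0[OF U] by simp
  next
    case (step y z)
    then have "(axis i 1 - axis y 1) + (axis y 1 - axis z 1) \<in> U"
      by (intro subspace_add[OF U]) (auto intro: edge)
    then show ?case by simp
  qed
qed

text \<open>
  The roots together with a single basis vector \<open>e\<^sub>k\<close> span the whole space, and adding one vector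
  raises the dimension by at most one.
\<close>

lemma dim_if_all_roots:
  fixes U :: "(real ^ 'n::finite) set"
  assumes roots: "\<And>i j. axis i 1 - axis j 1 \<in> span U"
  shows "CARD('n) \<le> dim U + 1"
proof -
  fix k :: 'n
  let ?V = "insert (axis k 1) U"
  have "axis i 1 \<in> span ?V" for i
  proof -
    have "axis i 1 - axis k 1 \<in> span ?V"
      using roots span_mono[of U ?V] by blast
    then have "(axis i 1 - axis k 1) + axis k 1 \<in> span ?V"
      by (rule span_add) (simp add: span_base)
    then show ?thesis by simp
  qed
  then have "(Basis :: (real ^ 'n) set) \<subseteq> span ?V"
    by (auto simp: Basis_vec_def)
  then have "span (Basis :: (real ^ 'n) set) \<subseteq> span ?V"
    by (rule span_minimal) (rule subspace_span)
  then have "dim (UNIV :: (real ^ 'n) set) \<le> dim ?V"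
    unfolding span_Basis by (rule dim_mono)
  then have "CARD('n) \<le> dim ?V"
    by simp
  also have "\<dots> \<le> dim U + 1"
    unfolding dim_insert by simp
  finally show ?thesis .
qed

theorem proposition5p3:
  fixes S :: "('n::{finite,linorder} \<Rightarrow> 'n) set"
  assumes "S \<subseteq> sym_grp"
    and "card S = CARD('n)"
    and "graph_connected (UNIV :: 'n set) (transposition_graph S)"
  shows "persistent_simplex S"
  unfolding persistent_simplex_def
proof (intro conjI ballI assms(1,2))
  fix a :: "real ^ 'n::{finite,linorder}" assume "a \<in> fundamental_chamber"
  then have a: "inj (($) a)" by (rule inj_component_fundamental_chamber)
  let ?P = "(\<lambda>w. perm_act w a) ` S"
  have card: "card ?P = CARD('n)"
    using card_image[OF inj_on_subset[OF perm_act_inj_on_sym_grp[OF a] assms(1)]] assms(2) by simp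
  have "S \<noteq> {}" using assms(2) by force
  then obtain b where b: "b \<in> ?P" by blast
  let ?D = "(+) (- b) ` ?P"
  have edge: "axis i 1 - axis j 1 \<in> span ?D" if "{i, j} \<in> transposition_graph S" for i j
  proof -
    from that obtain k l v w where kl: "{i, j} = {k, l}" and vw: "k \<noteq> l" "v \<in> S" "w \<in> S"
      "v \<circ> inv w = Transposition.transpose k l"
      unfolding transposition_graph_def by blast
    have ij: "i \<noteq> j" using kl vw(1) by (metis doubleton_eq_iff)
    have tr: "v \<circ> inv w = Transposition.transpose i j"
      using kl vw(4) by (metis doubleton_eq_iff transpose_commute)
    have w: "bij w" using vw(3) assms(1) by (auto intro: permutes_bij)
    have "v = v \<circ> (inv w \<circ> w)" using bij_is_inj[OF w] by simp
    also have "\<dots> = Transposition.transpose i j \<circ> w"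
      unfolding o_assoc tr ..
    finally have v: "v = Transposition.transpose i j \<circ> w" .
    let ?c = "a $ inv w j - a $ inv w i"
    have "(perm_act v a - b) - (perm_act w a - b) \<in> span ?D"
      by (intro span_diff span_base) (use vw in auto)
    then have "?c *\<^sub>R (axis i 1 - axis j 1) \<in> span ?D"
      using perm_act_transpose_diff[OF w, of i j a] v by simp
    then have "inverse ?c *\<^sub>R ?c *\<^sub>R (axis i 1 - axis j 1) \<in> span ?D"
      by (rule span_scale)
    moreover have "?c \<noteq> 0"
      using ij inj_eq[OF a] inj_eq[OF bij_is_inj[OF bij_imp_bij_inv[OF w]]] by simp
    ultimately show ?thesis by simp
  qed
  have "CARD('n) \<le> dim ?D + 1"
    by (rule dim_if_all_roots[OF roots_in_subspace_if_connected[OF subspace_span assms(3) edge]])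
  moreover have "aff_dim ?P = int (dim ?D)"
    by (rule aff_dim_eq_dim) (use b in \<open>rule hull_inc\<close>)
  moreover have "finite ?P" by simp
  ultimately have "\<not> affine_dependent ?P"
    using aff_dim_le_card[of ?P] card by (simp add: affine_independent_iff_card)
  then show "(int CARD('n) - 1) simplex (convex hull ?P)"
    unfolding simplex_def using card by auto
qed

end
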